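(* Let $m\ge1$, $n\ge2$ be integers with $m+n\ge4$, let $p=p_{m+n}$, let $U$ be the positive radial solution of $-\Delta U+U=U^{p-1}$ on $\mathbb{R}^n$ described in the context, and set $$\beta=\int_{\mathbb{R}^n}U^2\,dz-\frac{a_{m+n}}{n(n+2)}\int_{\mathbb{R}^n}|\nabla U|^2|z|^2\,dz .$$ (i) If $m+n=4$, then $\beta<0$. (ii) If $n\ne4$ and $m+n>4$, then $$\beta=\frac{6-a_{m+n}}{n(n-4)}\int_{\mathbb{R}^n}\left(\frac2p\cdot\frac{m}{m+n-4}\,U^p-U^2\right)|z|^2\,dz .$$
   Context: $a_k=\frac{4(k-1)}{k-2}$ and $p_k=\frac{2k}{k-2}$ for $k\ge3$. $U$ is the unique positive finite-energy ($H^1$) solution on $\mathbb{R}^n$, radial about the origin, of $-\Delta U+U=U^{p-1}$ with $p=p_{m+n}$; $U$ and $\nabla U$ decay exponentially at infinity. In the paper $\beta=a_{m+n}\beta_{m,n}$, where $n=\dim M$ and $m=\dim N$. *)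

theory Defs
  imports "HOL-Analysis.Analysis"
begin

definition a_const :: "nat \<Rightarrow> real" where
  "a_const k = 4 * (real k - 1) / (real k - 2)"

definition p_const :: "nat \<Rightarrow> real" where
  "p_const k = 2 * real k / (real k - 2)"

definition partial_deriv :: "'a::euclidean_space \<Rightarrow> ('a \<Rightarrow> real) \<Rightarrow> 'a \<Rightarrow> real" where
  "partial_deriv b f z = frechet_derivative f (at z) b"

definition grad :: "('a::euclidean_space \<Rightarrow> real) \<Rightarrow> 'a \<Rightarrow> 'a" where
  "grad f z = (\<Sum>b\<in>Basis. partial_deriv b f z *\<^sub>R b)"

definition laplacian :: "('a::euclidean_space \<Rightarrow> real) \<Rightarrow> 'a \<Rightarrow> real" where
  "laplacian f z = (\<Sum>b\<in>Basis. partial_deriv b (partial_deriv b f) z)"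

text \<open>The Frechet derivative of a function that is not differentiable is unspecified, so
  differentiability of \<open>f\<close> and of its first partial derivatives is required explicitly.\<close>

definition C2 :: "('a::euclidean_space \<Rightarrow> real) \<Rightarrow> bool" where
  "C2 f \<longleftrightarrow>
     (\<forall>z. f differentiable (at z)) \<and>
     (\<forall>b\<in>Basis. \<forall>z. partial_deriv b f differentiable (at z)) \<and>
     (\<forall>b\<in>Basis. \<forall>b'\<in>Basis. continuous_on UNIV (partial_deriv b' (partial_deriv b f)))"

definition radial :: "('a::real_normed_vector \<Rightarrow> 'b) \<Rightarrow> bool" where
  "radial f \<longleftrightarrow> (\<forall>x y. norm x = norm y \<longrightarrow> f x = f y)"

text \<open>For \<open>C2\<close> functions the weak gradient is the classical one, so this is membership in
  \<open>H\<^sup>1\<close> of the whole space.\<close>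

definition finite_energy :: "('a::euclidean_space \<Rightarrow> real) \<Rightarrow> bool" where
  "finite_energy f \<longleftrightarrow>
     integrable lborel (\<lambda>z. (f z)\<^sup>2) \<and> integrable lborel (\<lambda>z. (norm (grad f z))\<^sup>2)"

definition decays_exponentially ::
    "('a::real_normed_vector \<Rightarrow> 'b::real_normed_vector) \<Rightarrow> bool" where
  "decays_exponentially f \<longleftrightarrow>
     (\<exists>C. \<exists>c>0. \<forall>\<^sub>F z in at_infinity. norm (f z) \<le> C * exp (- c * norm z))"

text \<open>Solutions are classical: by elliptic regularity positive finite-energy weak solutions
  with subcritical exponent are smooth.\<close>

definition ground_state :: "real \<Rightarrow> ('a::euclidean_space \<Rightarrow> real) \<Rightarrow> bool" where
  "ground_state p U \<longleftrightarrow>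
     C2 U \<and> (\<forall>z. U z > 0) \<and> radial U \<and> finite_energy U \<and>
     (\<forall>z. - laplacian U z + U z = U z powr (p - 1))"

end

(*
  All integrations by parts are radial: since t^n * (integral of f(t z)) is independent of t,
  differentiating at t = 1 gives  integral of (n f + z . grad f) = 0  for every decaying f.
  With R = z . grad U = r U', radiality gives |z|^2 |grad U|^2 = R^2 and, by the equation,
  z . grad R = |z|^2 (U - U^(p-1)) - (n - 2) R.  Taking f = U^2, U R, R^2, |z|^2 U^2, |z|^2 U^p
  yields
    n A = B + C - D   and   (n - 4) B = (n + 2) (2 D / p - C)
  for the integrals A, B, C, D of U^2, |grad U|^2 |z|^2, U^2 |z|^2, U^p |z|^2; the theorem is
  then arithmetic, with n beta = - D / 2 in the case m + n = 4.
*)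

theory Submission
  imports Defs
begin

section \<open>Integrability of exponential weights\<close>

lemma integrable_exp_minus_abs:
  fixes c :: real
  assumes "c > 0"
  shows "integrable lborel (\<lambda>x::real. exp (- c * \<bar>x\<bar>))"
proof -
  let ?f = "\<lambda>x::real. indicator {0..} x * exp (- c * x)"
  have "(\<integral>\<^sup>+x. ennreal (exp (- c * x)) * indicator {0..} x \<partial>lborel) = ennreal (0 - (- exp (- c * 0) / c))"
  proof (rule nn_integral_FTC_atLeast)
    show "((\<lambda>x. - exp (- c * x) / c) \<longlongrightarrow> 0) at_top"
    proof -
      have "filterlim (\<lambda>x. - c * x) at_bot at_top"
        using assms by (intro filterlim_tendsto_neg_mult_at_bot[OF tendsto_const] filterlim_ident) simp
      then have "((\<lambda>x. exp (- c * x)) \<longlongrightarrow> 0) at_top"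
        by (rule filterlim_compose[OF exp_at_bot])
      then show ?thesis
        using tendsto_divide[OF tendsto_minus tendsto_const, of _ 0 at_top c] assms by simp
    qed
  qed (use assms in \<open>auto intro!: derivative_eq_intros\<close>)
  then have int: "integrable lborel ?f"
    by (intro integrableI_bounded) (auto simp: indicator_mult_ennreal mult.commute abs_mult
        intro!: le_less_trans[OF eq_refl])
  \<comment> \<open>The negative half-line is obtained by the reflection
    \<open>0 + (-1) * x\<close>, in affine form; the two half-line functions together dominate the
    even one.\<close>
  then have int': "integrable lborel (\<lambda>x. ?f (0 + (-1) * x))"
    by (rule lborel_integrable_real_affine) simp
  show ?thesis
    by (rule Bochner_Integration.integrable_bound[OF Bochner_Integration.integrable_add[OF int int']])
      (auto simp: indicator_def)
qed

text \<open>Reduction to dimension one: each coordinate is bounded by \<open>norm z\<close>, so with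
  the rate \<open>c\<close> shared equally among the coordinates, a product of one-dimensional
  exponentials dominates.\<close>

lemma integrable_exp_minus_norm:
  fixes c :: real
  assumes "c > 0"
  shows "integrable lborel (\<lambda>z::'a::euclidean_space. exp (- c * norm z))"
proof -
  interpret product_sigma_finite "\<lambda>b::'a. lborel :: real measure"
    by standard
  let ?d = "c / DIM('a)"
  have d: "?d > 0" using assms by simp
  let ?P = "\<lambda>z::'a. \<Prod>b\<in>Basis. exp (- ?d * \<bar>z \<bullet> b\<bar>)"
  have "integrable (\<Pi>\<^sub>M b\<in>(Basis::'a set). lborel) (\<lambda>x. \<Prod>b\<in>Basis. exp (- ?d * \<bar>x b\<bar>))"
    using d by (intro product_integrable_prod integrable_exp_minus_abs) auto
  then have "integrable lborel ?P"
    by (subst lborel_eq, subst integrable_distr_eq)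
      (auto simp: inner_sum_left inner_Basis if_distrib cong: prod.cong if_cong)
  then show ?thesis
  proof (rule Bochner_Integration.integrable_bound)
    show "AE z in lborel. norm (exp (- c * norm z)) \<le> norm (?P z)"
    proof (rule AE_I2)
      fix z :: 'a
      have "(\<Sum>b\<in>Basis. ?d * \<bar>z \<bullet> b\<bar>) \<le> (\<Sum>b\<in>(Basis::'a set). ?d * norm z)"
        using d by (intro sum_mono mult_left_mono) (auto simp: Basis_le_norm)
      also have "\<dots> = c * norm z" by simp
      finally show "norm (exp (- c * norm z)) \<le> norm (?P z)"
        by (simp add: exp_sum[symmetric] sum_negf abs_prod)
    qed
  qed simp
qed

section \<open>Calculus of exponential decay\<close>

lemma decays_exponentially_mono:
  assumes "decays_exponentially f"
    and "\<forall>\<^sub>F z in at_infinity. norm (g z) \<le> norm (f z)"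
  shows "decays_exponentially g"
proof -
  obtain C c where c: "c > 0"
    and f: "\<forall>\<^sub>F z in at_infinity. norm (f z) \<le> C * exp (- c * norm z)"
    using assms(1) unfolding decays_exponentially_def by blast
  have "\<forall>\<^sub>F z in at_infinity. norm (g z) \<le> C * exp (- c * norm z)"
    using f assms(2) by eventually_elim (rule order_trans)
  then show ?thesis
    unfolding decays_exponentially_def using c by blast
qed

lemma decays_exponentially_add:
  fixes f g :: "'a::real_normed_vector \<Rightarrow> 'b::real_normed_vector"
  assumes "decays_exponentially f" "decays_exponentially g"
  shows "decays_exponentially (\<lambda>z. f z + g z)"
proof -
  obtain C c D d where c: "c > 0" "d > 0"
    and f: "\<forall>\<^sub>F z in at_infinity. norm (f z) \<le> C * exp (- c * norm z)"
    and g: "\<forall>\<^sub>F z in at_infinity. norm (g z) \<le> D * exp (- d * norm z)"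
    using assms unfolding decays_exponentially_def by blast
  \<comment> \<open>The slower of the two rates survives. Absolute values are taken because
    \<open>C\<close> and \<open>D\<close> come without a sign, and passing to a slower rate enlarges
    the bound only for nonnegative constants.\<close>
  have "\<forall>\<^sub>F z in at_infinity.
      norm (f z + g z) \<le> (\<bar>C\<bar> + \<bar>D\<bar>) * exp (- min c d * norm z)"
    using f g
  proof eventually_elim
    case (elim z)
    have "C * exp (- c * norm z) \<le> \<bar>C\<bar> * exp (- min c d * norm z)"
      by (intro mult_mono) (auto intro: mult_right_mono)
    moreover have "D * exp (- d * norm z) \<le> \<bar>D\<bar> * exp (- min c d * norm z)"
      by (intro mult_mono) (auto intro: mult_right_mono)
    ultimately show ?case
      using elim norm_triangle_ineq[of "f z" "g z"] unfolding distrib_right by linarith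
  qed
  then show ?thesis
    unfolding decays_exponentially_def using c by (metis min_less_iff_conj)
qed

lemma decays_exponentially_mult:
  fixes f g :: "'a::real_normed_vector \<Rightarrow> real"
  assumes "decays_exponentially f" "decays_exponentially g"
  shows "decays_exponentially (\<lambda>z. f z * g z)"
proof -
  obtain C c D d where c: "c > 0" "d > 0"
    and f: "\<forall>\<^sub>F z in at_infinity. norm (f z) \<le> C * exp (- c * norm z)"
    and g: "\<forall>\<^sub>F z in at_infinity. norm (g z) \<le> D * exp (- d * norm z)"
    using assms unfolding decays_exponentially_def by blast
  have "\<forall>\<^sub>F z in at_infinity. norm (f z * g z) \<le> (C * D) * exp (- (c + d) * norm z)"
    using f g
  proof eventually_elim
    case (elim z)
    have "norm (f z * g z) \<le> (C * exp (- c * norm z)) * (D * exp (- d * norm z))"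
      unfolding norm_mult using elim order_trans[OF norm_ge_zero elim(1)] by (intro mult_mono) auto
    also have "\<dots> = (C * D) * (exp (- c * norm z) * exp (- d * norm z))"
      by (simp only: mult_ac)
    also have "exp (- c * norm z) * exp (- d * norm z) = exp (- (c + d) * norm z)"
      by (simp add: exp_add[symmetric] algebra_simps)
    finally show ?case .
  qed
  then show ?thesis
    unfolding decays_exponentially_def using c by (metis add_pos_pos)
qed

lemma decays_exponentially_cmult:
  fixes f :: "'a::real_normed_vector \<Rightarrow> real"
  assumes "decays_exponentially f"
  shows "decays_exponentially (\<lambda>z. k * f z)"
proof -
  obtain C c where c: "c > 0"
    and f: "\<forall>\<^sub>F z in at_infinity. norm (f z) \<le> C * exp (- c * norm z)"
    using assms unfolding decays_exponentially_def by blast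
  have "\<forall>\<^sub>F z in at_infinity. norm (k * f z) \<le> (\<bar>k\<bar> * C) * exp (- c * norm z)"
    using f by eventually_elim (auto simp: abs_mult mult.assoc intro: mult_left_mono)
  then show ?thesis
    unfolding decays_exponentially_def using c by blast
qed

text \<open>Half of the rate is spent on the linear factor, since t is at most \<open>exp t\<close>
  for t = \<open>c / 2 * norm z\<close>. Applied twice, this absorbs the weight |z|^2.\<close>

lemma decays_exponentially_norm_mult:
  fixes f :: "'a::real_normed_vector \<Rightarrow> real"
  assumes "decays_exponentially f"
  shows "decays_exponentially (\<lambda>z. norm z * f z)"
proof -
  obtain C c where c: "c > 0"
    and f: "\<forall>\<^sub>F z in at_infinity. norm (f z) \<le> C * exp (- c * norm z)"
    using assms unfolding decays_exponentially_def by blast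
  have "\<forall>\<^sub>F z in at_infinity. norm (norm z * f z) \<le> (2 / c * C) * exp (- (c / 2) * norm z)"
    using f
  proof eventually_elim
    case (elim z)
    have "c / 2 * norm z \<le> exp (c / 2 * norm z)"
      using exp_ge_add_one_self[of "c / 2 * norm z"] by linarith
    then have "norm z \<le> 2 / c * exp (c / 2 * norm z)"
      using c by (simp add: field_simps)
    then have "norm z * norm (f z) \<le> (2 / c * exp (c / 2 * norm z)) * (C * exp (- c * norm z))"
      using elim c by (intro mult_mono) auto
    also have "\<dots> = (2 / c * C) * (exp (c / 2 * norm z) * exp (- c * norm z))"
      by (simp add: algebra_simps)
    also have "exp (c / 2 * norm z) * exp (- c * norm z) = exp (- (c / 2) * norm z)"
      by (simp add: exp_add[symmetric] field_simps)
    finally show ?case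
      by (simp add: abs_mult)
  qed
  then show ?thesis
    unfolding decays_exponentially_def using c by (metis half_gt_zero)
qed

lemma decays_exponentially_powr:
  fixes f :: "'a::real_normed_vector \<Rightarrow> real"
  assumes "decays_exponentially f" and "\<And>z. f z > 0" and "q > 0"
  shows "decays_exponentially (\<lambda>z. f z powr q)"
proof -
  obtain C c where c: "c > 0"
    and f: "\<forall>\<^sub>F z in at_infinity. norm (f z) \<le> C * exp (- c * norm z)"
    using assms unfolding decays_exponentially_def by blast
  have "\<forall>\<^sub>F z in at_infinity. norm (f z powr q) \<le> (\<bar>C\<bar> powr q) * exp (- (q * c) * norm z)"
    using f
  proof eventually_elim
    case (elim z)
    have "C * exp (- c * norm z) \<le> \<bar>C\<bar> * exp (- c * norm z)"
      by (intro mult_right_mono) auto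
    then have "f z powr q \<le> (\<bar>C\<bar> * exp (- c * norm z)) powr q"
      using elim assms(2)[of z] \<open>q > 0\<close> unfolding real_norm_def by (intro powr_mono2) linarith+
    also have "\<dots> = (\<bar>C\<bar> powr q) * exp (- (q * c) * norm z)"
      by (simp add: powr_mult exp_powr_real mult_ac)
    finally show ?case by simp
  qed
  then show ?thesis
    unfolding decays_exponentially_def using c \<open>q > 0\<close> by (metis mult_pos_pos)
qed

text \<open>Compactness of a ball upgrades the bound near infinity to a global one, which can serve
  as an integrable majorant.\<close>

lemma continuous_decays_exponentially_bound:
  fixes f :: "'a::euclidean_space \<Rightarrow> 'b::real_normed_vector"
  assumes "continuous_on UNIV f" and "decays_exponentially f"
  obtains C c where "C \<ge> 0" "c > 0" "\<And>z. norm (f z) \<le> C * exp (- c * norm z)"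
proof -
  obtain C c where c: "c > 0"
    and f: "\<forall>\<^sub>F z in at_infinity. norm (f z) \<le> C * exp (- c * norm z)"
    using assms(2) unfolding decays_exponentially_def by blast
  from f obtain b where b: "\<And>z. norm z \<ge> b \<Longrightarrow> norm (f z) \<le> C * exp (- c * norm z)"
    unfolding eventually_at_infinity by blast
  have "compact (f ` cball 0 b)"
    using assms(1) by (intro compact_continuous_image) (auto intro: continuous_on_subset)
  then obtain M where M: "\<And>z. norm z \<le> b \<Longrightarrow> norm (f z) \<le> M"
    by (metis bounded_iff compact_imp_bounded imageI mem_cball_0)
  \<comment> \<open>The first summand serves outside the ball of radius \<open>b\<close>; inside,
    \<open>exp (c * b) * exp (- c * norm z)\<close> is at least 1, so the second one majorizes
    \<open>M\<close>.\<close>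
  define K where "K = \<bar>C\<bar> + \<bar>M\<bar> * exp (c * b)"
  have "norm (f z) \<le> K * exp (- c * norm z)" for z
  proof (cases "norm z \<ge> b")
    case True
    have "norm (f z) \<le> C * exp (- c * norm z)" using b True .
    also have "\<dots> \<le> K * exp (- c * norm z)"
      unfolding K_def by (intro mult_right_mono add_increasing2) auto
    finally show ?thesis .
  next
    case False
    have "norm (f z) \<le> \<bar>M\<bar> * 1" using M[of z] False by auto
    also have "\<dots> \<le> \<bar>M\<bar> * (exp (c * b) * exp (- c * norm z))"
      unfolding exp_add[symmetric] using False c by (intro mult_left_mono) auto
    also have "\<dots> \<le> K * exp (- c * norm z)"
      unfolding K_def distrib_right mult.assoc by auto
    finally show ?thesis .
  qed
  moreover have "K \<ge> 0" by (simp add: K_def)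
  ultimately show ?thesis using that c by blast
qed

lemma integrable_decays_exponentially:
  fixes f :: "'a::euclidean_space \<Rightarrow> real"
  assumes "continuous_on UNIV f" and "decays_exponentially f"
  shows "integrable lborel f"
proof -
  obtain C c where "c > 0" and f: "\<And>z. norm (f z) \<le> C * exp (- c * norm z)"
    using continuous_decays_exponentially_bound[OF assms] by metis
  have "integrable lborel (\<lambda>z::'a. C * exp (- c * norm z))"
    using integrable_exp_minus_norm[OF \<open>c > 0\<close>] by (intro integrable_mult_right) auto
  then show ?thesis
  proof (rule Bochner_Integration.integrable_bound)
    show "f \<in> borel_measurable lborel"
      using assms(1) by (simp add: borel_measurable_continuous_onI)
    show "AE z in lborel. norm (f z) \<le> norm (C * exp (- c * norm z))"
      using order_trans[OF f abs_ge_self] by simp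
  qed
qed

section \<open>Dilations and the Euler identity\<close>

lemma integral_lborel_scaleR:
  fixes f :: "'a::euclidean_space \<Rightarrow> real"
  assumes "f \<in> borel_measurable borel" and "c > 0"
  shows "(\<integral>z. c ^ DIM('a) * f (c *\<^sub>R z) \<partial>lborel) = (\<integral>z. f z \<partial>lborel)"
proof -
  have "(lborel :: 'a measure) = density (distr lborel borel (\<lambda>x. 0 + c *\<^sub>R x)) (\<lambda>_. ennreal (c ^ DIM('a)))"
    using lborel_affine[of c "0::'a"] assms by (simp add: ennreal_power)
  then have "(\<integral>z. f z \<partial>lborel) =
      (\<integral>z. f z \<partial>density (distr lborel borel (\<lambda>x. 0 + c *\<^sub>R x)) (\<lambda>_. ennreal (c ^ DIM('a))))"
    by (rule arg_cong)
  also have "\<dots> = (\<integral>z. c ^ DIM('a) * f (c *\<^sub>R z) \<partial>lborel)"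
    using assms by (subst integral_density) (auto simp: integral_distr)
  finally show ?thesis ..
qed

lemma integrable_lborel_scaleR:
  fixes f :: "'a::euclidean_space \<Rightarrow> real"
  assumes f: "integrable lborel f" and "c > 0"
  shows "integrable lborel (\<lambda>z. f (c *\<^sub>R z))"
proof -
  have "integrable (density (distr lborel borel (\<lambda>x. 0 + c *\<^sub>R x)) (\<lambda>_. ennreal (c ^ DIM('a)))) f"
    using lborel_affine[of c "0::'a"] assms by (simp add: ennreal_power)
  then show ?thesis
    using assms by (subst (asm) integrable_density) (auto simp: integrable_distr_eq)
qed

text \<open>This is the divergence theorem for the field \<phi>(z) z with no boundary term;
  \<open>\<phi>' z z\<close> is z . grad \<phi>. Dilation invariance gives difference quotients of
  integral zero, and dominated convergence passes to their limit.\<close>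

lemma integral_euler_identity:
  fixes \<phi> :: "'a::euclidean_space \<Rightarrow> real"
  assumes deriv: "\<And>z. (\<phi> has_derivative \<phi>' z) (at z)"
    and cont: "continuous_on UNIV (\<lambda>z. \<phi>' z z)"
    and dec: "decays_exponentially \<phi>" "decays_exponentially (\<lambda>z. \<phi>' z z)"
  shows "real DIM('a) * (\<integral>z. \<phi> z \<partial>lborel) + (\<integral>z. \<phi>' z z \<partial>lborel) = 0"
proof -
  let ?n = "DIM('a)"
  define g where "g z = ?n * \<phi> z + \<phi>' z z" for z
  have cont\<phi>: "continuous_on UNIV \<phi>"
    using deriv by (intro has_derivative_continuous_on) auto
  note int\<phi> = integrable_decays_exponentially[OF cont\<phi> dec(1)]
  note int\<phi>' = integrable_decays_exponentially[OF cont dec(2)]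
  have "continuous_on UNIV g"
    unfolding g_def by (intro continuous_intros cont\<phi> cont)
  moreover have "decays_exponentially g"
    unfolding g_def by (intro decays_exponentially_add decays_exponentially_cmult dec)
  ultimately obtain C c where C: "C \<ge> 0" "c > 0" "\<And>z. norm (g z) \<le> C * exp (- c * norm z)"
    using continuous_decays_exponentially_bound by blast
  have meas: "\<phi> \<in> borel_measurable borel" "g \<in> borel_measurable borel"
    using cont\<phi> \<open>continuous_on UNIV g\<close> by (auto intro: borel_measurable_continuous_onI)
  define F where "F z t = t ^ ?n * \<phi> (t *\<^sub>R z)" for z t
  \<comment> \<open>Linearity turns t times \<open>\<phi>' (t *\<^sub>R z) z\<close> into the
    derivative applied to \<open>t *\<^sub>R z\<close>, so \<open>g\<close> appears at the dilated
    point and a power of t factors out. The truncated subtraction \<open>?n - 1\<close> is harmless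
    as the dimension is positive.\<close>
  have DF: "((F z) has_field_derivative t ^ (?n - 1) * g (t *\<^sub>R z)) (at t)" for z t
  proof -
    have lin: "linear (\<phi>' w)" for w
      using deriv has_derivative_linear by blast
    have "((\<lambda>t. \<phi> (t *\<^sub>R z)) has_derivative (\<lambda>h. \<phi>' (t *\<^sub>R z) (h *\<^sub>R z))) (at t)"
      by (rule has_derivative_compose[OF _ deriv]) (auto intro!: derivative_eq_intros)
    then have "((\<lambda>t. \<phi> (t *\<^sub>R z)) has_field_derivative \<phi>' (t *\<^sub>R z) z) (at t)"
      by (simp add: has_field_derivative_def linear_scale[OF lin] mult.commute[of _ "\<phi>' _ _"])
    then have "((F z) has_field_derivative
        ?n * t ^ (?n - 1) * \<phi> (t *\<^sub>R z) + \<phi>' (t *\<^sub>R z) z * t ^ ?n) (at t)"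
      unfolding F_def by (auto intro!: derivative_eq_intros)
    moreover have "t ^ ?n = t ^ (?n - 1) * t"
      using DIM_positive[where 'a='a] by (simp add: power_eq_if)
    ultimately show ?thesis
      by (simp add: g_def linear_scale[OF lin] algebra_simps)
  qed
  \<comment> \<open>A null sequence, as dominated convergence requires; with values in (0,1] it
    keeps the dilation factors between 1 and 2.\<close>
  define h :: "nat \<Rightarrow> real" where "h k = 1 / (real k + 1)" for k
  have h: "0 < h k" "h k \<le> 1" for k by (auto simp: h_def)
  define s where "s k z = (F z (1 + h k) - F z 1) / h k" for k z
  have "(\<lambda>k. \<integral>z. s k z \<partial>lborel) \<longlonglongrightarrow> (\<integral>z. g z \<partial>lborel)"
  proof (rule integral_dominated_convergence[where w="\<lambda>z. 2 ^ (?n - 1) * (C * exp (- c * norm z))"])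
    show "integrable lborel (\<lambda>z::'a. 2 ^ (?n - 1) * (C * exp (- c * norm z)))"
      using integrable_exp_minus_norm[OF \<open>c > 0\<close>] by (intro integrable_mult_right) auto
    show "AE z in lborel. (\<lambda>k. s k z) \<longlonglongrightarrow> g z"
    proof (rule AE_I2)
      fix z :: 'a
      have "((\<lambda>t. (F z (1 + t) - F z 1) / t) \<longlongrightarrow> g z) (at 0)"
        using DF[of z 1] by (simp add: DERIV_def)
      moreover have "filterlim h (at 0) sequentially"
        unfolding h_def filterlim_at
        using LIMSEQ_inverse_real_of_nat by (auto simp: inverse_eq_divide add.commute)
      ultimately show "(\<lambda>k. s k z) \<longlonglongrightarrow> g z"
        unfolding s_def by (rule filterlim_compose)
    qed
    show "AE z in lborel. norm (s k z) \<le> 2 ^ (?n - 1) * (C * exp (- c * norm z))" for k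
    proof (rule AE_I2)
      fix z :: 'a
      \<comment> \<open>By the mean value theorem the quotient is a derivative at some \<theta> in
        (1,2): the power is at most \<open>2 ^ (?n - 1)\<close>, and moving from z outward to
        \<theta> z only improves the exponential bound.\<close>
      obtain \<theta> where \<theta>: "1 < \<theta>" "\<theta> < 1 + h k"
        and eq: "F z (1 + h k) - F z 1 = (1 + h k - 1) * (\<theta> ^ (?n - 1) * g (\<theta> *\<^sub>R z))"
        using MVT2[of 1 "1 + h k" "F z", OF _ DF] h[of k] by auto
      have "norm (s k z) = \<theta> ^ (?n - 1) * norm (g (\<theta> *\<^sub>R z))"
        using h[of k] \<theta> unfolding s_def eq by (simp add: abs_mult)
      also have "\<dots> \<le> 2 ^ (?n - 1) * (C * exp (- c * norm z))"
      proof (intro mult_mono power_mono)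
        have "norm (g (\<theta> *\<^sub>R z)) \<le> C * exp (- c * norm (\<theta> *\<^sub>R z))"
          by (rule C)
        also have "\<dots> \<le> C * exp (- c * norm z)"
          using C \<theta> by (intro mult_left_mono) (auto simp: mult_le_cancel_right1)
        finally show "norm (g (\<theta> *\<^sub>R z)) \<le> C * exp (- c * norm z)" .
      qed (use \<theta> h[of k] in auto)
      finally show "norm (s k z) \<le> 2 ^ (?n - 1) * (C * exp (- c * norm z))" .
    qed
    show "s k \<in> borel_measurable lborel" for k
      unfolding s_def F_def using meas by measurable
  qed (use meas in simp)
  moreover have "(\<integral>z. s k z \<partial>lborel) = 0" for k
  proof -
    have pos: "1 + h k > 0" using h[of k] by simp
    have "(\<integral>z. F z (1 + h k) - F z 1 \<partial>lborel) = (\<integral>z. F z (1 + h k) \<partial>lborel) - (\<integral>z. F z 1 \<partial>lborel)"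
      unfolding F_def
      by (intro Bochner_Integration.integral_diff integrable_mult_right integrable_lborel_scaleR int\<phi> pos) simp
    also have "\<dots> = 0"
      unfolding F_def integral_lborel_scaleR[OF meas(1) pos] by simp
    finally show ?thesis
      by (simp add: s_def)
  qed
  ultimately have "(\<integral>z. g z \<partial>lborel) = 0"
    by (simp add: LIMSEQ_const_iff)
  then show ?thesis
    unfolding g_def using int\<phi> int\<phi>' by simp
qed

section \<open>Gradients and radial functions\<close>

lemma frechet_derivative_eq_grad_inner:
  fixes f :: "'a::euclidean_space \<Rightarrow> real"
  assumes "f differentiable (at z)"
  shows "frechet_derivative f (at z) v = grad f z \<bullet> v"
proof -
  interpret linear "frechet_derivative f (at z)"
    using assms by (rule linear_frechet_derivative)
  have "frechet_derivative f (at z) v = frechet_derivative f (at z) (\<Sum>b\<in>Basis. (v \<bullet> b) *\<^sub>R b)"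
    by (simp only: euclidean_representation)
  also have "\<dots> = grad f z \<bullet> v"
    unfolding grad_def partial_deriv_def inner_sum_left sum scale
    by (simp add: inner_commute mult.commute)
  finally show ?thesis .
qed

lemma grad_inner_Basis:
  "b \<in> Basis \<Longrightarrow> grad f z \<bullet> b = partial_deriv b f z"
  by (simp add: grad_def)

lemma has_derivative_grad:
  fixes f :: "'a::euclidean_space \<Rightarrow> real"
  assumes "f differentiable (at z)"
  shows "(f has_derivative (\<lambda>v. grad f z \<bullet> v)) (at z)"
proof -
  have "frechet_derivative f (at z) = (\<lambda>v. grad f z \<bullet> v)"
    using frechet_derivative_eq_grad_inner[OF assms] by blast
  then show ?thesis
    using assms unfolding frechet_derivative_works by simp
qed

text \<open>The great circle from \<open>z\<close> towards \<open>w\<close> stays on a sphere, so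
  \<open>f\<close> is constant along it; its velocity at the start is \<open>w\<close>.\<close>

lemma radial_grad_inner_orthogonal:
  fixes f :: "'a::euclidean_space \<Rightarrow> real"
  assumes "radial f" "f differentiable (at z)" and orth: "z \<bullet> w = 0" and norm: "norm w = norm z"
  shows "grad f z \<bullet> w = 0"
proof -
  let ?\<gamma> = "\<lambda>t. cos t *\<^sub>R z + sin t *\<^sub>R w"
  have "norm (?\<gamma> t) = norm z" for t
  proof -
    have "(norm (?\<gamma> t))\<^sup>2 = (cos t)\<^sup>2 * (norm z)\<^sup>2 + (sin t)\<^sup>2 * (norm w)\<^sup>2"
      unfolding power2_norm_eq_inner using orth
      by (simp add: inner_simps inner_commute[of w z] power2_eq_square mult_ac)
    also have "\<dots> = (norm z)\<^sup>2"
      unfolding norm distrib_right[symmetric] by (simp add: sin_cos_squared_add2)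
    finally show ?thesis by simp
  qed
  then have "f (?\<gamma> t) = f z" for t
    using \<open>radial f\<close> unfolding radial_def by blast
  moreover have "((\<lambda>t. f (?\<gamma> t)) has_derivative (\<lambda>h. grad f z \<bullet> (h *\<^sub>R w))) (at 0)"
  proof (rule has_derivative_compose[of ?\<gamma> "\<lambda>h. h *\<^sub>R w" _ _ f "\<lambda>v. grad f z \<bullet> v"])
    show "(?\<gamma> has_derivative (\<lambda>h. h *\<^sub>R w)) (at 0)"
      by (auto intro!: derivative_eq_intros)
    show "(f has_derivative (\<lambda>v. grad f z \<bullet> v)) (at (?\<gamma> 0))"
      using has_derivative_grad[OF assms(2)] by simp
  qed
  ultimately have "((\<lambda>t. f z) has_derivative (\<lambda>h. grad f z \<bullet> (h *\<^sub>R w))) (at (0::real))"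
    by simp
  from has_derivative_unique[OF this has_derivative_const] have "grad f z \<bullet> (1 *\<^sub>R w) = 0"
    by metis
  then show ?thesis by simp
qed

lemma radial_grad_parallel:
  fixes f :: "'a::euclidean_space \<Rightarrow> real"
  assumes "radial f" "f differentiable (at z)"
  shows "(norm z)\<^sup>2 *\<^sub>R grad f z = (z \<bullet> grad f z) *\<^sub>R z"
proof (cases "z = 0")
  case False
  \<comment> \<open>This is |z|^2 times the component of the gradient orthogonal to z, in
    division-free form. Rescaled to length \<open>norm z\<close>, it is an admissible direction for
    the great circle argument.\<close>
  define w where "w = (norm z)\<^sup>2 *\<^sub>R grad f z - (z \<bullet> grad f z) *\<^sub>R z"
  have orth: "z \<bullet> w = 0"
    by (simp add: w_def inner_simps power2_norm_eq_inner)
  have "w = 0"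
  proof (rule ccontr)
    assume "w \<noteq> 0"
    then have "grad f z \<bullet> ((norm z / norm w) *\<^sub>R w) = 0"
      using orth by (intro radial_grad_inner_orthogonal assms) auto
    then have "grad f z \<bullet> w = 0"
      using \<open>w \<noteq> 0\<close> False by simp
    then have "w \<bullet> w = 0"
      using orth by (subst (1) w_def) (simp add: inner_simps)
    then show False using \<open>w \<noteq> 0\<close> by simp
  qed
  then show ?thesis by (simp add: w_def)
qed simp

lemma radial_norm_grad:
  fixes f :: "'a::euclidean_space \<Rightarrow> real"
  assumes "radial f" "f differentiable (at z)"
  shows "(norm (grad f z))\<^sup>2 * (norm z)\<^sup>2 = (z \<bullet> grad f z)\<^sup>2"
proof -
  have "((norm z)\<^sup>2 *\<^sub>R grad f z) \<bullet> grad f z = ((z \<bullet> grad f z) *\<^sub>R z) \<bullet> grad f z"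
    using radial_grad_parallel[OF assms] by simp
  then show ?thesis
    by (simp add: power2_norm_eq_inner[of "grad f z"] power2_eq_square[of "z \<bullet> grad f z"] mult.commute)
qed

text \<open>The infinitesimal rotation in the plane of \<open>i\<close> and \<open>j\<close>
  annihilates radial functions. Being valid at every point, the identity can be differentiated to
  reach second derivatives.\<close>

lemma radial_partial_deriv_rotation:
  fixes f :: "'a::euclidean_space \<Rightarrow> real"
  assumes "radial f" "f differentiable (at z)" and ij: "i \<in> Basis" "j \<in> Basis"
  shows "(z \<bullet> i) * partial_deriv j f z = (z \<bullet> j) * partial_deriv i f z"
proof (cases "z = 0")
  case False
  have *: "(norm z)\<^sup>2 * partial_deriv b f z = (z \<bullet> grad f z) * (z \<bullet> b)" if "b \<in> Basis" for b
    using arg_cong[OF radial_grad_parallel[OF assms(1,2)], of "\<lambda>x. x \<bullet> b"] that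
    by (simp add: grad_inner_Basis)
  have "(norm z)\<^sup>2 * ((z \<bullet> i) * partial_deriv j f z) = (norm z)\<^sup>2 * ((z \<bullet> j) * partial_deriv i f z)"
    using *[OF ij(1)] *[OF ij(2)] by (simp add: mult.left_commute[of "(norm z)\<^sup>2"])
  then show ?thesis using False by simp
qed simp

lemma has_derivative_inner_grad:
  fixes f :: "'a::euclidean_space \<Rightarrow> real"
  assumes "\<And>b. b \<in> Basis \<Longrightarrow> partial_deriv b f differentiable (at z)"
  shows "((\<lambda>z. z \<bullet> grad f z) has_derivative
    (\<lambda>v. \<Sum>j\<in>Basis. (v \<bullet> j) * partial_deriv j f z + (z \<bullet> j) * (grad (partial_deriv j f) z \<bullet> v))) (at z)"
proof -
  have eq: "(\<lambda>z. z \<bullet> grad f z) = (\<lambda>z. \<Sum>j\<in>Basis. (z \<bullet> j) * partial_deriv j f z)"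
    by (simp add: grad_def inner_sum_right mult.commute)
  show ?thesis
    unfolding eq
    by (rule has_derivative_sum)
      (auto intro!: derivative_eq_intros has_derivative_grad assms simp: add.commute)
qed

text \<open>With \<open>R = r U'\<close> this is \<open>r R' = r\<^sup>2 U'' + r U' = r\<^sup>2 \<Delta>U - (n - 2) R\<close>.\<close>

lemma radial_euler_derivative:
  fixes f :: "'a::euclidean_space \<Rightarrow> real"
  assumes f: "radial f" "C2 f"
  shows "(\<Sum>j\<in>Basis. (z \<bullet> j) * partial_deriv j f z + (z \<bullet> j) * (grad (partial_deriv j f) z \<bullet> z))
    = (norm z)\<^sup>2 * laplacian f z - (real DIM('a) - 2) * (z \<bullet> grad f z)"
proof -
  note diff = f(2)[unfolded C2_def]
  \<comment> \<open>The rotation identity is differentiated in direction \<open>i\<close>; this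
    trades a mixed second derivative for the pure one in direction \<open>i\<close>.\<close>
  have rot: "(i \<bullet> i) * partial_deriv j f z + (z \<bullet> i) * partial_deriv i (partial_deriv j f) z
      = (i \<bullet> j) * partial_deriv i f z + (z \<bullet> j) * partial_deriv i (partial_deriv i f) z"
    if ij: "i \<in> Basis" "j \<in> Basis" for i j
  proof -
    have deriv: "((\<lambda>z. (z \<bullet> k) * partial_deriv l f z) has_derivative
        (\<lambda>v. (v \<bullet> k) * partial_deriv l f z + (z \<bullet> k) * (grad (partial_deriv l f) z \<bullet> v))) (at z)"
      if "k \<in> Basis" "l \<in> Basis" for k l
      using diff that by (auto intro!: derivative_eq_intros has_derivative_grad simp: add.commute)
    have "(\<lambda>z. (z \<bullet> j) * partial_deriv i f z) = (\<lambda>z. (z \<bullet> i) * partial_deriv j f z)"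
      using radial_partial_deriv_rotation[OF f(1)] diff ij by blast
    note has_derivative_unique[OF deriv[OF ij] deriv[OF ij(2,1), unfolded this]]
    from fun_cong[OF this, of i] show ?thesis
      using ij by (simp only: grad_inner_Basis)
  qed
  \<comment> \<open>Summing \<open>rot\<close> over \<open>i\<close> assembles the Laplacian; the
    first-order terms contribute \<open>DIM('a)\<close> copies of the \<open>j\<close>-th partial
    derivative on one side and one on the other.\<close>
  have hess: "grad (partial_deriv j f) z \<bullet> z
      = (z \<bullet> j) * laplacian f z - (real DIM('a) - 1) * partial_deriv j f z"
    if j: "j \<in> Basis" for j
  proof -
    have "(\<Sum>i\<in>Basis. (i \<bullet> i) * partial_deriv j f z + (z \<bullet> i) * partial_deriv i (partial_deriv j f) z)
      = (\<Sum>i\<in>Basis. (i \<bullet> j) * partial_deriv i f z + (z \<bullet> j) * partial_deriv i (partial_deriv i f) z)"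
      using rot j by (intro sum.cong) auto
    moreover have "(\<Sum>i\<in>Basis. (i \<bullet> j) * partial_deriv i f z) = partial_deriv j f z"
      using j by (simp add: inner_Basis if_distrib[of "\<lambda>x. x * _"] cong: if_cong)
    moreover have "(\<Sum>i\<in>(Basis::'a set). (i \<bullet> i) * partial_deriv j f z) = real DIM('a) * partial_deriv j f z"
      by (simp add: inner_same_Basis)
    moreover have "grad (partial_deriv j f) z \<bullet> z = (\<Sum>i\<in>Basis. (z \<bullet> i) * partial_deriv i (partial_deriv j f) z)"
      by (simp add: grad_def inner_sum_left inner_commute[of z] mult.commute)
    ultimately show ?thesis
      by (simp add: sum.distrib laplacian_def sum_distrib_left algebra_simps)
  qed
  have R: "z \<bullet> grad f z = (\<Sum>j\<in>Basis. (z \<bullet> j) * partial_deriv j f z)"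
    by (simp add: grad_def inner_sum_right mult.commute)
  \<comment> \<open>The product-rule term offsets one copy of the first derivative, which changes
    the coefficient n - 1 of \<open>hess\<close> into n - 2.\<close>
  have "(\<Sum>j\<in>Basis. (z \<bullet> j) * partial_deriv j f z + (z \<bullet> j) * (grad (partial_deriv j f) z \<bullet> z))
    = (\<Sum>j\<in>Basis. (z \<bullet> j) * (z \<bullet> j) * laplacian f z - (real DIM('a) - 2) * ((z \<bullet> j) * partial_deriv j f z))"
    by (intro sum.cong refl) (simp add: hess algebra_simps)
  also have "\<dots> = (norm z)\<^sup>2 * laplacian f z - (real DIM('a) - 2) * (z \<bullet> grad f z)"
    unfolding sum_subtractf sum_distrib_right[symmetric] sum_distrib_left[symmetric] R
      euclidean_inner[symmetric] power2_norm_eq_inner ..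
  finally show ?thesis .
qed

section \<open>Integral identities for the ground state\<close>

text \<open>Five Euler identities link \<open>A\<close>, \<open>B\<close>, \<open>C\<close>,
  \<open>D\<close> and the auxiliary integrals \<open>P\<close>, \<open>Q\<close>, \<open>T\<close>;
  eliminating these three leaves two relations. Positivity of \<open>D\<close> makes the inequality
  for m + n = 4 strict.\<close>

lemma ground_state_integral_identities:
  fixes U :: "'a::euclidean_space \<Rightarrow> real" and p :: real
  assumes U: "ground_state p U" and p: "p > 1"
    and U_decay: "decays_exponentially U"
    and grad_U_decay: "decays_exponentially (grad U)"
  defines "A \<equiv> (\<integral>z. (U z)\<^sup>2 \<partial>lborel)"
    and "B \<equiv> (\<integral>z. (norm (grad U z))\<^sup>2 * (norm z)\<^sup>2 \<partial>lborel)"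
    and "C \<equiv> (\<integral>z. (U z)\<^sup>2 * (norm z)\<^sup>2 \<partial>lborel)"
    and "D \<equiv> (\<integral>z. U z powr p * (norm z)\<^sup>2 \<partial>lborel)"
  shows "real DIM('a) * A = B + C - D"
    and "(real DIM('a) - 4) * B = (real DIM('a) + 2) * (2 / p * D - C)"
    and "D > 0"
    and "integrable lborel (\<lambda>z. (U z)\<^sup>2 * (norm z)\<^sup>2)"
    and "integrable lborel (\<lambda>z. U z powr p * (norm z)\<^sup>2)"
proof -
  let ?n = "real DIM('a)"
  define R where "R z = z \<bullet> grad U z" for z
  define R' where "R' z v = (\<Sum>j\<in>Basis. (v \<bullet> j) * partial_deriv j U z
    + (z \<bullet> j) * (grad (partial_deriv j U) z \<bullet> v))" for z v
  from U have C2: "C2 U" and pos: "\<And>z. U z > 0" and rad: "radial U"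
    and eqn: "\<And>z. - laplacian U z + U z = U z powr (p - 1)"
    by (auto simp: ground_state_def)
  have diff: "U differentiable (at z)" for z
    using C2 by (simp add: C2_def)
  have pdiff: "partial_deriv b U differentiable (at z)" if "b \<in> Basis" for b z
    using C2 that by (simp add: C2_def)
  have dU: "(U has_derivative (\<lambda>v. grad U z \<bullet> v)) (at z)" for z
    using has_derivative_grad[OF diff] .
  have dR: "(R has_derivative R' z) (at z)" for z
    unfolding R_def R'_def using has_derivative_inner_grad[OF pdiff] .
  \<comment> \<open>The equation enters here. It removes second derivatives, so continuity and decay
    of every later integrand follow from those of \<open>U\<close>, \<open>R\<close>, powers of
    \<open>U\<close> and polynomial weights.\<close>
  have R'_self: "R' z z = (norm z)\<^sup>2 * (U z - U z powr (p - 1)) - (?n - 2) * R z" for z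
  proof -
    have "laplacian U z = U z - U z powr (p - 1)"
      using eqn[of z] by linarith
    then show ?thesis
      using radial_euler_derivative[OF rad C2, of z] by (simp only: R_def R'_def)
  qed
  have gradR: "grad U z \<bullet> z = R z" for z by (simp add: R_def inner_commute)
  have R2: "(norm (grad U z))\<^sup>2 * (norm z)\<^sup>2 = (R z)\<^sup>2" for z
    unfolding R_def by (rule radial_norm_grad[OF rad diff])
  have powr_Suc: "U z * U z powr (p - 1) = U z powr p" for z
    using pos[of z] powr_mult_base[of "U z" "p - 1"] by simp

  have contU: "continuous_on UNIV U"
    using dU by (intro has_derivative_continuous_on) auto
  have contR: "continuous_on UNIV R"
    using dR by (intro has_derivative_continuous_on) auto
  have contpow: "continuous_on UNIV (\<lambda>z. U z powr q)" for q
    using pos by (intro continuous_intros contU) (metis less_irrefl)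
  note cont = contU contR contpow continuous_intros

  have decR: "decays_exponentially R"
  proof (rule decays_exponentially_mono)
    show "decays_exponentially (\<lambda>z. norm z * norm (grad U z))"
      by (intro decays_exponentially_norm_mult decays_exponentially_mono[OF grad_U_decay]) simp
    show "\<forall>\<^sub>F z in at_infinity. norm (R z) \<le> norm (norm z * norm (grad U z))"
      by (simp add: R_def Cauchy_Schwarz_ineq2)
  qed
  have dec2: "decays_exponentially (\<lambda>z. (norm z)\<^sup>2 * f z)" if "decays_exponentially f" for f :: "'a \<Rightarrow> real"
    using decays_exponentially_norm_mult[OF decays_exponentially_norm_mult[OF that]]
    by (simp add: power2_eq_square mult.assoc)
  have decpow: "decays_exponentially (\<lambda>z. U z powr p)" "decays_exponentially (\<lambda>z. U z powr (p - 1))"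
    using p by (auto intro!: decays_exponentially_powr U_decay pos)
  note dec = U_decay decR decpow dec2
    decays_exponentially_cmult decays_exponentially_add decays_exponentially_mult

  have dpow: "((\<lambda>z. U z powr p) has_derivative (\<lambda>v. p * U z powr (p - 1) * (grad U z \<bullet> v))) (at z)" for z
    using has_derivative_compose[OF dU has_real_derivative_powr[OF pos[of z], of p, unfolded has_field_derivative_def]] .
  have dnorm: "((\<lambda>z::'a. (norm z)\<^sup>2) has_derivative (\<lambda>v. 2 * (z \<bullet> v))) (at z)" for z
    unfolding power2_norm_eq_inner by (auto intro!: derivative_eq_intros simp: inner_commute)

  define P where "P = (\<integral>z. U z * R z \<partial>lborel)"
  define Q where "Q = (\<integral>z. (norm z)\<^sup>2 * (U z * R z) \<partial>lborel)"
  define T where "T = (\<integral>z. (norm z)\<^sup>2 * (U z powr (p - 1) * R z) \<partial>lborel)"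
  \<comment> \<open>The integrals are rewritten as plain products with the weight in front, the
    shape that the collected rules \<open>dec\<close> handle.\<close>
  have B: "B = (\<integral>z. R z * R z \<partial>lborel)"
    unfolding B_def R2 by (simp add: power2_eq_square)
  have C: "C = (\<integral>z. (norm z)\<^sup>2 * (U z * U z) \<partial>lborel)"
    unfolding C_def by (simp add: power2_eq_square mult_ac)
  have D: "D = (\<integral>z. (norm z)\<^sup>2 * U z powr p \<partial>lborel)"
    unfolding D_def by (simp add: mult.commute)
  have A: "A = (\<integral>z. U z * U z \<partial>lborel)"
    unfolding A_def power2_eq_square ..

  have int: "integrable lborel (\<lambda>z. U z * U z)" "integrable lborel (\<lambda>z. U z * R z)"
    "integrable lborel (\<lambda>z. R z * R z)" "integrable lborel (\<lambda>z. (norm z)\<^sup>2 * (U z * U z))"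
    "integrable lborel (\<lambda>z. (norm z)\<^sup>2 * (U z * R z))"
    "integrable lborel (\<lambda>z. (norm z)\<^sup>2 * U z powr p)"
    "integrable lborel (\<lambda>z. (norm z)\<^sup>2 * (U z powr (p - 1) * R z))"
    by (intro integrable_decays_exponentially cont dec)+

  \<comment> \<open>The radial derivative \<open>\<phi>' z z\<close> is separated from its
    simplified form \<open>g\<close>, on which continuity and decay are checked.\<close>
  have euler: "?n * (\<integral>z. \<phi> z \<partial>lborel) + (\<integral>z. g z \<partial>lborel) = 0"
    if "\<And>z. (\<phi> has_derivative \<phi>' z) (at z)" "\<And>z. \<phi>' z z = g z"
      "continuous_on UNIV g" "decays_exponentially \<phi>" "decays_exponentially g"
    for \<phi> g :: "'a \<Rightarrow> real" and \<phi>'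
    using integral_euler_identity[of \<phi> \<phi>'] that by simp

  have 1: "?n * A + 2 * P = 0"
  proof -
    have "?n * A + (\<integral>z. 2 * (U z * R z) \<partial>lborel) = 0"
      unfolding A
    proof (rule euler)
      show "((\<lambda>z. U z * U z) has_derivative (\<lambda>v. U z * (grad U z \<bullet> v) + (grad U z \<bullet> v) * U z)) (at z)" for z
        by (intro has_derivative_mult dU)
    qed ((simp add: gradR; fail), (intro cont), (intro dec)+)
    then show ?thesis by (simp add: P_def)
  qed
  have 2: "?n * P + (B + C - D + (2 - ?n) * P) = 0"
  proof -
    \<comment> \<open>Differences are written as sums with negative coefficients, to match
      \<open>decays_exponentially_add\<close> and \<open>decays_exponentially_cmult\<close>.\<close>
    have "?n * P + (\<integral>z. R z * R z + (norm z)\<^sup>2 * (U z * U z) + (- 1) * ((norm z)\<^sup>2 * U z powr p)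
        + (- (?n - 2)) * (U z * R z) \<partial>lborel) = 0"
      unfolding P_def
    proof (rule euler)
      show "((\<lambda>z. U z * R z) has_derivative (\<lambda>v. U z * R' z v + (grad U z \<bullet> v) * R z)) (at z)" for z
        by (intro has_derivative_mult dU dR)
    qed ((simp add: gradR R'_self powr_Suc[symmetric] algebra_simps; fail), (intro cont), (intro dec)+)
    then show ?thesis
      using int by (simp add: B C D P_def)
  qed
  have 3: "?n * B + (2 * Q - 2 * T + (4 - 2 * ?n) * B) = 0"
  proof -
    have "?n * B + (\<integral>z. 2 * ((norm z)\<^sup>2 * (U z * R z)) + (- 2) * ((norm z)\<^sup>2 * (U z powr (p - 1) * R z))
        + (- 2 * (?n - 2)) * (R z * R z) \<partial>lborel) = 0"
      unfolding B
    proof (rule euler)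
      show "((\<lambda>z. R z * R z) has_derivative (\<lambda>v. R z * R' z v + R' z v * R z)) (at z)" for z
        by (intro has_derivative_mult dR)
    qed ((simp add: R'_self algebra_simps; fail), (intro cont), (intro dec)+)
    then show ?thesis
      using int by (simp add: B Q_def T_def)
  qed
  \<comment> \<open>Here and in \<open>5\<close> the extra summand, \<open>2 * C\<close> or
    \<open>2 * D\<close>, comes from the weight |z|^2, which is homogeneous of degree 2.\<close>
  have 4: "?n * C + (2 * C + 2 * Q) = 0"
  proof -
    have "?n * C + (\<integral>z. 2 * ((norm z)\<^sup>2 * (U z * U z)) + 2 * ((norm z)\<^sup>2 * (U z * R z)) \<partial>lborel) = 0"
      unfolding C
    proof (rule euler)
      show "((\<lambda>z. (norm z)\<^sup>2 * (U z * U z)) has_derivative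
          (\<lambda>v. (norm z)\<^sup>2 * (U z * (grad U z \<bullet> v) + (grad U z \<bullet> v) * U z) + 2 * (z \<bullet> v) * (U z * U z))) (at z)" for z
        by (intro has_derivative_mult dU dnorm)
    qed ((simp add: gradR power2_norm_eq_inner[symmetric] algebra_simps; fail), (intro cont), (intro dec)+)
    then show ?thesis
      using int by (simp add: C Q_def)
  qed
  have 5: "?n * D + (2 * D + p * T) = 0"
  proof -
    have "?n * D + (\<integral>z. 2 * ((norm z)\<^sup>2 * U z powr p) + p * ((norm z)\<^sup>2 * (U z powr (p - 1) * R z)) \<partial>lborel) = 0"
      unfolding D
    proof (rule euler)
      show "((\<lambda>z. (norm z)\<^sup>2 * U z powr p) has_derivative
          (\<lambda>v. (norm z)\<^sup>2 * (p * U z powr (p - 1) * (grad U z \<bullet> v)) + 2 * (z \<bullet> v) * U z powr p)) (at z)" for z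
        by (intro has_derivative_mult dpow dnorm)
    qed ((simp add: gradR power2_norm_eq_inner[symmetric] algebra_simps; fail), (intro cont), (intro dec)+)
    then show ?thesis
      using int by (simp add: D T_def)
  qed
  \<comment> \<open>The terms in n \<open>P\<close> cancel in \<open>2\<close>, and the remaining
    \<open>2 * P\<close> is - n \<open>A\<close> by \<open>1\<close>.\<close>
  show "?n * A = B + C - D"
    using 1 2 by (simp add: algebra_simps)
  have T: "T = - ((?n + 2) * D / p)"
    using 5 p by (simp add: field_simps)
  have "(?n - 4) * B = 2 * Q - 2 * T"
    using 3 by (simp add: algebra_simps)
  also have "2 * T = - ((?n + 2) * (2 / p * D))"
    by (simp add: T mult_ac)
  also have "2 * Q = - ((?n + 2) * C)"
    using 4 by (simp add: algebra_simps)
  also have "- ((?n + 2) * C) - - ((?n + 2) * (2 / p * D)) = (?n + 2) * (2 / p * D - C)"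
    by (simp only: right_diff_distrib)
  finally show "(?n - 4) * B = (?n + 2) * (2 / p * D - C)" .
  show "integrable lborel (\<lambda>z. (U z)\<^sup>2 * (norm z)\<^sup>2)" "integrable lborel (\<lambda>z. U z powr p * (norm z)\<^sup>2)"
    using int by (simp_all add: power2_eq_square mult_ac)
  show "D > 0"
  proof -
    \<comment> \<open>The integrand vanishes only at the origin, a null set. A zero integral would
      make it vanish almost everywhere, which is impossible since the whole space is not
      null.\<close>
    have "AE z in lborel. 0 < U z powr p * (norm z)\<^sup>2"
      using AE_lborel_singleton[of "0::'a"] by eventually_elim (use pos in \<open>simp add: less_imp_neq[symmetric]\<close>)
    then have "AE z in lborel :: 'a measure. False" if "AE z in lborel. U z powr p * (norm z)\<^sup>2 = 0"
      using that by eventually_elim simp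
    then have "\<not> (AE z in lborel. U z powr p * (norm z)\<^sup>2 = 0)"
      by (auto simp: eventually_False ae_filter_eq_bot_iff)
    moreover have "D \<ge> 0" unfolding D_def by simp
    moreover have "D = 0 \<longleftrightarrow> (AE z in lborel. U z powr p * (norm z)\<^sup>2 = 0)"
      unfolding D_def
      by (rule integral_nonneg_eq_0_iff_AE)
        (use \<open>integrable lborel (\<lambda>z. U z powr p * (norm z)\<^sup>2)\<close> in auto)
    ultimately show ?thesis by linarith
  qed
qed

section \<open>Arithmetic with the two relations\<close>

theorem theorem6p1:
  fixes m n :: nat and p \<beta> :: real and U :: "real ^ 'n \<Rightarrow> real"
  assumes n_def: "n = CARD('n)"
    and "m \<ge> 1" and "n \<ge> 2" and "m + n \<ge> 4"
    and p_def: "p = p_const (m + n)"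
    and U: "ground_state p U"
    and U_decay: "decays_exponentially U"
    and grad_U_decay: "decays_exponentially (grad U)"
    and \<beta>_def: "\<beta> = (\<integral>z. (U z)\<^sup>2 \<partial>lborel)
        - a_const (m + n) / (real n * (real n + 2))
          * (\<integral>z. (norm (grad U z))\<^sup>2 * (norm z)\<^sup>2 \<partial>lborel)"
  shows "(m + n = 4 \<longrightarrow> \<beta> < 0) \<and>
    (n \<noteq> 4 \<and> m + n > 4 \<longrightarrow>
      \<beta> = (6 - a_const (m + n)) / (real n * (real n - 4))
        * (\<integral>z. (2 / p * (real m / (real m + real n - 4)) * U z powr p - (U z)\<^sup>2)
              * (norm z)\<^sup>2 \<partial>lborel))"
proof -
  let ?a = "a_const (m + n)"
  define x y where "x = real m" and "y = real n"
  have N: "x + y \<ge> 4" "y \<ge> 2" "x \<ge> 1"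
    using assms(2-4) by (simp_all add: x_def y_def flip: of_nat_add)
  have p: "p = 2 * (x + y) / (x + y - 2)"
    by (simp add: p_def p_const_def x_def y_def)
  have a: "?a = 4 * (x + y - 1) / (x + y - 2)"
    by (simp add: a_const_def x_def y_def)
  have "p > 1" using N by (simp add: p field_simps)
  define A B C D where "A = (\<integral>z. (U z)\<^sup>2 \<partial>lborel)"
    and "B = (\<integral>z. (norm (grad U z))\<^sup>2 * (norm z)\<^sup>2 \<partial>lborel)"
    and "C = (\<integral>z. (U z)\<^sup>2 * (norm z)\<^sup>2 \<partial>lborel)"
    and "D = (\<integral>z. U z powr p * (norm z)\<^sup>2 \<partial>lborel)"
  note * = ground_state_integral_identities[OF U \<open>p > 1\<close> U_decay grad_U_decay, folded A_def B_def C_def D_def]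
  have dim: "real DIM(real ^ 'n) = y" by (simp add: n_def y_def)
  have 1: "y * A = B + C - D" and 2: "(y - 4) * B = (y + 2) * (2 / p * D - C)" and "D > 0"
    using *(1-3) unfolding dim by auto
  have \<beta>: "\<beta> = A - ?a / (y * (y + 2)) * B"
    by (simp add: \<beta>_def A_def B_def y_def)
  have y\<beta>: "y * \<beta> = B + C - D - ?a / (y + 2) * B"
    using N by (simp add: \<beta> right_diff_distrib 1)
  have "\<beta> < 0" if "m + n = 4"
  proof -
    have xy: "x + y = 4" using that by (simp add: x_def y_def flip: of_nat_add)
    have "p = 4" "?a = 6" unfolding p a xy by simp_all
    \<comment> \<open>With a = 6 the coefficient of \<open>B\<close> is 1 - 6 / (y + 2) = (y - 4) /
      (y + 2), so relation \<open>2\<close> eliminates \<open>B\<close> without dividing by y -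
      4.\<close>
    then have "y * \<beta> = (y - 4) * B / (y + 2) + C - D"
      using N unfolding y\<beta> by (simp add: field_simps)
    also have "\<dots> = - D / 2"
      using N unfolding 2 \<open>p = 4\<close> by (simp add: field_simps)
    finally have "y * \<beta> < 0" using \<open>D > 0\<close> by simp
    then show ?thesis using N by (simp add: mult_less_0_iff)
  qed
  moreover have "\<beta> = (6 - ?a) / (y * (y - 4))
        * (\<integral>z. (2 / p * (x / (x + y - 4)) * U z powr p - (U z)\<^sup>2) * (norm z)\<^sup>2 \<partial>lborel)"
    if "n \<noteq> 4" "m + n > 4"
  proof -
    have xy: "x + y > 4" "y \<noteq> 4" using that by (simp_all add: x_def y_def flip: of_nat_add)
    let ?k = "2 / p * (x / (x + y - 4))"
    have int: "(\<integral>z. (?k * U z powr p - (U z)\<^sup>2) * (norm z)\<^sup>2 \<partial>lborel) = ?k * D - C"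
      using *(4,5) by (simp add: C_def D_def left_diff_distrib mult.assoc)
    have B: "B = (y + 2) * (2 / p * D - C) / (y - 4)"
      using 2 xy by (simp add: field_simps)
    have "y * \<beta> = (y + 2 - ?a) / (y + 2) * B + C - D"
      using N unfolding y\<beta> by (simp add: field_simps)
    also have "\<dots> = (y + 2 - ?a) / (y - 4) * (2 / p * D - C) + C - D"
      using N unfolding B by simp
    \<comment> \<open>The coefficients of \<open>C\<close> and \<open>D\<close> are compared
      separately; for \<open>D\<close>, after clearing y - 4, both sides become
      \<open>2 * x / (x + y)\<close> by \<open>e1\<close> and \<open>e2\<close>.\<close>
    also have "\<dots> = (6 - ?a) / (y - 4) * (?k * D - C)"
    proof -
      have coeff_C: "(y + 2 - ?a) / (y - 4) - 1 = (6 - ?a) / (y - 4)"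
        using xy by (simp add: field_simps)
      have q: "2 / p = (x + y - 2) / (x + y)"
        using N by (simp add: p field_simps)
      have e: "6 - ?a = 2 * (x + y - 4) / (x + y - 2)"
        using N by (simp add: a field_simps)
      have cancel: "2 * u / v * (v / s * (x / u)) = 2 * x / s" if "u \<noteq> 0" "v \<noteq> 0" for u v s :: real
        using that by simp
      have e1: "(6 - ?a) * ?k = 2 * x / (x + y)"
        unfolding q e by (rule cancel) (use N xy in auto)
      have e2: "(y + 2 - ?a) * (2 / p) - (y - 4) = 2 * x / (x + y)"
      proof -
        have "y + 2 - ?a = ((y + 2) * (x + y - 2) - 4 * (x + y - 1)) / (x + y - 2)"
          using N by (simp add: a diff_divide_distrib)
        then have "(y + 2 - ?a) * (2 / p) = ((y + 2) * (x + y - 2) - 4 * (x + y - 1)) / (x + y)"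
          unfolding q using N by (simp only: times_divide_times_eq) simp
        then show ?thesis using N by (simp add: field_simps)
      qed
      \<comment> \<open>Puts the summand - 1 over the denominator y - 4, so that the numerator is
        the left side of \<open>e2\<close>.\<close>
      have quot: "u / d * v - 1 = (u * v - d) / d" if "d \<noteq> 0" for u v d :: real
        using that by (simp add: diff_divide_distrib)
      have coeff_D: "(y + 2 - ?a) / (y - 4) * (2 / p) - 1 = (6 - ?a) / (y - 4) * ?k"
        unfolding times_divide_eq_left[of "6 - ?a"] e1 e2[symmetric] by (rule quot) (use xy in simp)
      have "w * (e * D - C) + C - D = (w * e - 1) * D - (w - 1) * C" for w e
        by (simp add: algebra_simps)
      then have "(y + 2 - ?a) / (y - 4) * (2 / p * D - C) + C - D
          = ((y + 2 - ?a) / (y - 4) * (2 / p) - 1) * D - ((y + 2 - ?a) / (y - 4) - 1) * C" .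
      also have "\<dots> = (6 - ?a) / (y - 4) * (?k * D - C)"
        unfolding coeff_C coeff_D by (simp only: right_diff_distrib mult.assoc)
      finally show ?thesis .
    qed
    finally have y\<beta>': "y * \<beta> = (6 - ?a) / (y - 4) * (?k * D - C)" .
    have "\<beta> = (y * \<beta>) / y" using N by simp
    also have "\<dots> = (6 - ?a) / (y * (y - 4)) * (?k * D - C)"
      unfolding y\<beta>' by (simp only: times_divide_eq_left divide_divide_eq_left mult.commute)
    finally show ?thesis unfolding int .
  qed
  ultimately show ?thesis
    unfolding x_def y_def by blast
qed

end
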